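(* For every $L_\triangleright$ formula $\varphi$: $T_\triangleright+I\mathrm{Open}(L_\triangleright)\vdash\varphi$ if and only if $T^I_\triangleright\vdash\varphi$.
   Context: $L_\triangleright$ is the one-sorted first-order language with function symbols $0$ (constant), $s$, $p$ (unary), $+$ (binary, infix) and a binary predicate symbol $\triangleright$ (infix). $T_\triangleright$ is the theory with axioms (A1) $\forall x\, sx\neq 0$; (A2) $p0=0$; (A3) $\forall x\, p\,sx=x$; (A4) $\forall x\, x+0=x$; (A5) $\forall x\forall y\, x+sy=s(x+y)$; (A6) $0\triangleright 0$; (A7) $\forall x\forall y\,(x\triangleright y\to sx\triangleright (sx+y))$; (A8) $\forall x\forall y\,(sx\triangleright(sx+y)\to x\triangleright y)$; (A9) $\forall x\forall y\forall z\,(x\triangleright y\wedge x\triangleright z\to y=z)$. $T^I_\triangleright$ is $T_\triangleright$ together with (B1) $\forall x\,(x\neq0\to x=s\,p\,x)$; (B2) $\forall x\forall y\, x+y=y+x$; (B3) $\forall x\forall y\forall z\,(x+y)+z=x+(y+z)$; (B4) $\forall x\forall y\forall z\,(x+y=x+z\to y=z)$. For a formula $\psi(x,\vec z)$, $I_x\psi:=\forall\vec z\,(\psi(0,\vec z)\to\forall x(\psi(x,\vec z)\to\psi(sx,\vec z))\to\forall x\,\psi(x,\vec z))$, and $I\mathrm{Open}(L_\triangleright)$ is the set of all $I_x\psi$ with $\psi$ a quantifier-free $L_\triangleright$ formula. *)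

theory Defs
  imports Main
begin

section \<open>Syntax\<close>

text \<open>
  Variables are de Bruijn indices: in a formula under \<open>k\<close> quantifiers, index \<open>i < k\<close> is bound by
  the \<open>i\<close>-th enclosing quantifier counted from the inside, and index \<open>i \<ge> k\<close> is the free
  variable \<open>i - k\<close>.
\<close>

datatype tm =
    Var nat
  | Zero ("\<^bold>0")
  | Succ tm ("\<^bold>s _" [90] 90)
  | Pred tm ("\<^bold>p _" [90] 90)
  | Plus tm tm (infixl "\<^bold>+" 85)

datatype fm =
    Falsity ("\<^bold>\<bottom>")
  | Eq tm tm (infix "\<^bold>=" 80)
  | Tri tm tm (infix "\<triangleright>" 80)
  | Imp fm fm (infixr "\<^bold>\<longrightarrow>" 55)
  | All fm ("\<^bold>\<forall> _" [60] 60)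

abbreviation Neg :: "fm \<Rightarrow> fm" ("\<^bold>\<not> _" [70] 70) where
  "\<^bold>\<not> a \<equiv> a \<^bold>\<longrightarrow> \<^bold>\<bottom>"

abbreviation Con :: "fm \<Rightarrow> fm \<Rightarrow> fm" (infixr "\<^bold>\<and>" 65) where
  "a \<^bold>\<and> b \<equiv> \<^bold>\<not> (a \<^bold>\<longrightarrow> \<^bold>\<not> b)"

primrec vars_tm :: "tm \<Rightarrow> nat set" where
  "vars_tm (Var n) = {n}"
| "vars_tm \<^bold>0 = {}"
| "vars_tm (\<^bold>s t) = vars_tm t"
| "vars_tm (\<^bold>p t) = vars_tm t"
| "vars_tm (t \<^bold>+ u) = vars_tm t \<union> vars_tm u"

primrec free_vars :: "fm \<Rightarrow> nat set" where
  "free_vars \<^bold>\<bottom> = {}"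
| "free_vars (t \<^bold>= u) = vars_tm t \<union> vars_tm u"
| "free_vars (t \<triangleright> u) = vars_tm t \<union> vars_tm u"
| "free_vars (a \<^bold>\<longrightarrow> b) = free_vars a \<union> free_vars b"
| "free_vars (\<^bold>\<forall> a) = {n. Suc n \<in> free_vars a}"

primrec quantifier_free :: "fm \<Rightarrow> bool" where
  "quantifier_free \<^bold>\<bottom> = True"
| "quantifier_free (t \<^bold>= u) = True"
| "quantifier_free (t \<triangleright> u) = True"
| "quantifier_free (a \<^bold>\<longrightarrow> b) = (quantifier_free a \<and> quantifier_free b)"
| "quantifier_free (\<^bold>\<forall> a) = False"

text \<open>Simultaneous, capture-avoiding substitution of \<open>\<sigma> n\<close> for each free variable \<open>n\<close>.\<close>

primrec subst_tm :: "(nat \<Rightarrow> tm) \<Rightarrow> tm \<Rightarrow> tm" where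
  "subst_tm \<sigma> (Var n) = \<sigma> n"
| "subst_tm \<sigma> \<^bold>0 = \<^bold>0"
| "subst_tm \<sigma> (\<^bold>s t) = \<^bold>s (subst_tm \<sigma> t)"
| "subst_tm \<sigma> (\<^bold>p t) = \<^bold>p (subst_tm \<sigma> t)"
| "subst_tm \<sigma> (t \<^bold>+ u) = subst_tm \<sigma> t \<^bold>+ subst_tm \<sigma> u"

definition shift :: "nat \<Rightarrow> tm" where
  "shift n = Var (Suc n)"

definition under_binder :: "(nat \<Rightarrow> tm) \<Rightarrow> nat \<Rightarrow> tm" where
  "under_binder \<sigma> = case_nat (Var 0) (\<lambda>n. subst_tm shift (\<sigma> n))"

primrec subst :: "(nat \<Rightarrow> tm) \<Rightarrow> fm \<Rightarrow> fm" where
  "subst \<sigma> \<^bold>\<bottom> = \<^bold>\<bottom>"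
| "subst \<sigma> (t \<^bold>= u) = (subst_tm \<sigma> t \<^bold>= subst_tm \<sigma> u)"
| "subst \<sigma> (t \<triangleright> u) = (subst_tm \<sigma> t \<triangleright> subst_tm \<sigma> u)"
| "subst \<sigma> (a \<^bold>\<longrightarrow> b) = (subst \<sigma> a \<^bold>\<longrightarrow> subst \<sigma> b)"
| "subst \<sigma> (\<^bold>\<forall> a) = (\<^bold>\<forall> (subst (under_binder \<sigma>) a))"

text \<open>\<open>inst t a\<close> substitutes \<open>t\<close> for variable 0 of \<open>a\<close> and decrements the other free variables,
  so it is the instance at \<open>t\<close> of the quantified formula \<open>\<^bold>\<forall> a\<close>.\<close>

definition inst :: "tm \<Rightarrow> fm \<Rightarrow> fm" where
  "inst t = subst (case_nat t Var)"

section \<open>Provability\<close>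

text \<open>
  Natural deduction for classical first-order logic with equality. Shifting all assumptions in
  rule \<open>AllI\<close> makes variable 0 fresh for them, which is the eigenvariable condition.
\<close>

inductive proves :: "fm set \<Rightarrow> fm \<Rightarrow> bool" (infix "\<turnstile>" 50) where
  Assm: "a \<in> \<Gamma> \<Longrightarrow> \<Gamma> \<turnstile> a"
| ImpI: "insert a \<Gamma> \<turnstile> b \<Longrightarrow> \<Gamma> \<turnstile> a \<^bold>\<longrightarrow> b"
| ImpE: "\<Gamma> \<turnstile> a \<^bold>\<longrightarrow> b \<Longrightarrow> \<Gamma> \<turnstile> a \<Longrightarrow> \<Gamma> \<turnstile> b"
| RAA: "insert (\<^bold>\<not> a) \<Gamma> \<turnstile> \<^bold>\<bottom> \<Longrightarrow> \<Gamma> \<turnstile> a"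
| AllI: "subst shift ` \<Gamma> \<turnstile> a \<Longrightarrow> \<Gamma> \<turnstile> \<^bold>\<forall> a"
| AllE: "\<Gamma> \<turnstile> \<^bold>\<forall> a \<Longrightarrow> \<Gamma> \<turnstile> inst t a"
| Refl: "\<Gamma> \<turnstile> t \<^bold>= t"
| Leibniz: "\<Gamma> \<turnstile> t \<^bold>= u \<Longrightarrow> \<Gamma> \<turnstile> inst t a \<Longrightarrow> \<Gamma> \<turnstile> inst u a"

section \<open>The theories\<close>

definition T_tri :: "fm set" where
  "T_tri = (let x = Var 0 in
     {\<^bold>\<forall> \<^bold>\<not> (\<^bold>s x \<^bold>= \<^bold>0),
      \<^bold>p \<^bold>0 \<^bold>= \<^bold>0,
      \<^bold>\<forall> (\<^bold>p \<^bold>s x \<^bold>= x),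
      \<^bold>\<forall> (x \<^bold>+ \<^bold>0 \<^bold>= x),
      \<^bold>0 \<triangleright> \<^bold>0}) \<union>
   (let x = Var 1; y = Var 0 in
     {\<^bold>\<forall> \<^bold>\<forall> (x \<^bold>+ \<^bold>s y \<^bold>= \<^bold>s (x \<^bold>+ y)),
      \<^bold>\<forall> \<^bold>\<forall> (x \<triangleright> y \<^bold>\<longrightarrow> \<^bold>s x \<triangleright> \<^bold>s x \<^bold>+ y),
      \<^bold>\<forall> \<^bold>\<forall> (\<^bold>s x \<triangleright> \<^bold>s x \<^bold>+ y \<^bold>\<longrightarrow> x \<triangleright> y)}) \<union>
   (let x = Var 2; y = Var 1; z = Var 0 in
     {\<^bold>\<forall> \<^bold>\<forall> \<^bold>\<forall> (x \<triangleright> y \<^bold>\<and> x \<triangleright> z \<^bold>\<longrightarrow> y \<^bold>= z)})"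

definition T_tri_I :: "fm set" where
  "T_tri_I = T_tri \<union>
   (let x = Var 0 in
     {\<^bold>\<forall> (\<^bold>\<not> (x \<^bold>= \<^bold>0) \<^bold>\<longrightarrow> x \<^bold>= \<^bold>s \<^bold>p x)}) \<union>
   (let x = Var 1; y = Var 0 in
     {\<^bold>\<forall> \<^bold>\<forall> (x \<^bold>+ y \<^bold>= y \<^bold>+ x)}) \<union>
   (let x = Var 2; y = Var 1; z = Var 0 in
     {\<^bold>\<forall> \<^bold>\<forall> \<^bold>\<forall> ((x \<^bold>+ y) \<^bold>+ z \<^bold>= x \<^bold>+ (y \<^bold>+ z)),
      \<^bold>\<forall> \<^bold>\<forall> \<^bold>\<forall> (x \<^bold>+ y \<^bold>= x \<^bold>+ z \<^bold>\<longrightarrow> y \<^bold>= z)})"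

definition universal_closure :: "fm \<Rightarrow> fm" where
  "universal_closure a = (All ^^ (LEAST n. free_vars a \<subseteq> {..<n})) a"

text \<open>
  The induction variable \<open>x\<close> is variable 0 of \<open>a\<close>, and the parameters are its other free
  variables. The update \<open>Var(0 := \<^bold>s Var 0)\<close> is the substitution of \<open>\<^bold>s x\<close> for \<open>x\<close>, with \<open>x\<close> still
  bound by the surrounding quantifier.
\<close>

definition induction_axiom :: "fm \<Rightarrow> fm" where
  "induction_axiom a = universal_closure
     (inst \<^bold>0 a \<^bold>\<longrightarrow> \<^bold>\<forall> (a \<^bold>\<longrightarrow> subst (Var(0 := \<^bold>s Var 0)) a) \<^bold>\<longrightarrow> \<^bold>\<forall> a)"

definition IOpen :: "fm set" where
  "IOpen = {induction_axiom a | a. quantifier_free a}"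

end

theory Submission
  imports Defs "HOL-Library.Countable_Set"
begin

text \<open>
  By soundness and completeness it suffices that both theories have the same models. The axioms
  (B1)--(B4) are instances of open induction. Conversely, suppose that in a model of \<open>T_tri_I\<close> an
  open formula holds at 0 and is preserved by the successor, but fails at \<open>c\<close>. Then it holds on the
  chain \<open>0, 1, 2, \<dots>\<close> and fails on the chain \<open>c, c - 1, c - 2, \<dots>\<close>, both of which are infinite. This is
  impossible because every open formula has the same constant truth value at all but finitely many
  points of the two chains: terms \<open>t\<close> eventually satisfy an equation \<open>t(x) + h = m x + g\<close> with the same
  \<open>m\<close>, \<open>g\<close>, \<open>h\<close> on both chains, so by cancellation an equation of terms is eventually constant, and
  \<open>t \<triangleright> u\<close> is eventually constant if \<open>m = 0\<close> by functionality of \<open>\<triangleright>\<close>, and eventually false if \<open>m > 0\<close>.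
\<close>

section \<open>Substitution\<close>

lemma subst_tm_comp: "subst_tm \<tau> (subst_tm \<sigma> t) = subst_tm (\<lambda>n. subst_tm \<tau> (\<sigma> n)) t"
  by (induction t) auto

lemma subst_tm_Var [simp]: "subst_tm Var t = t"
  by (induction t) auto

lemma subst_tm_cong: "(\<And>n. n \<in> vars_tm t \<Longrightarrow> \<sigma> n = \<tau> n) \<Longrightarrow> subst_tm \<sigma> t = subst_tm \<tau> t"
  by (induction t) auto

lemma under_binder_simps [simp]:
  "under_binder \<sigma> 0 = Var 0" "under_binder \<sigma> (Suc n) = subst_tm shift (\<sigma> n)"
  by (auto simp: under_binder_def)

lemma under_binder_comp:
  "(\<lambda>n. subst_tm (under_binder \<tau>) (under_binder \<sigma> n)) = under_binder (\<lambda>n. subst_tm \<tau> (\<sigma> n))"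
proof
  fix n show "subst_tm (under_binder \<tau>) (under_binder \<sigma> n) = under_binder (\<lambda>n. subst_tm \<tau> (\<sigma> n)) n"
    by (cases n) (auto simp: subst_tm_comp shift_def)
qed

lemma under_binder_Var [simp]: "under_binder Var = Var"
proof
  fix n show "under_binder Var n = Var n"
    by (cases n) (auto simp: shift_def)
qed

lemma subst_comp: "subst \<tau> (subst \<sigma> a) = subst (\<lambda>n. subst_tm \<tau> (\<sigma> n)) a"
  by (induction a arbitrary: \<sigma> \<tau>) (auto simp: subst_tm_comp under_binder_comp)

lemma subst_Var [simp]: "subst Var a = a"
  by (induction a) auto

lemma subst_cong: "(\<And>n. n \<in> free_vars a \<Longrightarrow> \<sigma> n = \<tau> n) \<Longrightarrow> subst \<sigma> a = subst \<tau> a"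
proof (induction a arbitrary: \<sigma> \<tau>)
  case (All a)
  have "subst (under_binder \<sigma>) a = subst (under_binder \<tau>) a"
  proof (rule All.IH)
    fix n assume "n \<in> free_vars a"
    then show "under_binder \<sigma> n = under_binder \<tau> n"
      using All.prems by (cases n) auto
  qed
  then show ?case by simp
next
  case (Imp a b)
  have "subst \<sigma> a = subst \<tau> a" "subst \<sigma> b = subst \<tau> b"
    by (rule Imp.IH, simp add: Imp.prems)+
  then show ?case by simp
next
  case (Eq t u)
  have "subst_tm \<sigma> t = subst_tm \<tau> t" "subst_tm \<sigma> u = subst_tm \<tau> u"
    by (rule subst_tm_cong, simp add: Eq.prems)+
  then show ?case by simp
next
  case (Tri t u)
  have "subst_tm \<sigma> t = subst_tm \<tau> t" "subst_tm \<sigma> u = subst_tm \<tau> u"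
    by (rule subst_tm_cong, simp add: Tri.prems)+
  then show ?case by simp
qed simp

lemma subst_closed: "free_vars a = {} \<Longrightarrow> subst \<sigma> a = a"
  using subst_cong[of a \<sigma> Var] by simp

text \<open>Instantiation after a substitution under a binder acts like extending an assignment by
  one value. The quantifier case of \<open>term_model\<close> relies on this form.\<close>

lemma inst_under_binder: "inst t (subst (under_binder \<sigma>) a) = subst (case_nat t \<sigma>) a"
proof -
  have "(\<lambda>n. subst_tm (case_nat t Var) (under_binder \<sigma> n)) = case_nat t \<sigma>"
  proof
    fix n show "subst_tm (case_nat t Var) (under_binder \<sigma> n) = case_nat t \<sigma> n"
      by (cases n) (auto simp: subst_tm_comp shift_def)
  qed
  then show ?thesis by (simp add: inst_def subst_comp)
qed

lemma subst_inst: "subst \<sigma> (inst t a) = inst (subst_tm \<sigma> t) (subst (under_binder \<sigma>) a)"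
proof -
  have "(\<lambda>n. subst_tm \<sigma> (case_nat t Var n)) = case_nat (subst_tm \<sigma> t) \<sigma>"
    by (auto split: nat.splits)
  then show ?thesis by (simp add: inst_under_binder) (simp add: inst_def subst_comp)
qed

lemma subst_shift_tm [simp]: "subst_tm (case_nat u Var) (subst_tm shift t) = t"
  by (simp add: subst_tm_comp shift_def)

lemma finite_vars_tm [simp]: "finite (vars_tm t)"
  by (induction t) auto

lemma finite_free_vars [simp]: "finite (free_vars a)"
proof (induction a)
  case (All a)
  have "Suc ` {n. Suc n \<in> free_vars a} \<subseteq> free_vars a" by auto
  then have "finite (Suc ` {n. Suc n \<in> free_vars a})" using All finite_subset by blast
  then show ?case by (simp add: finite_image_iff)
qed auto

section \<open>Derivations\<close>

lemma weakening: "\<Gamma> \<turnstile> a \<Longrightarrow> \<Gamma> \<subseteq> \<Delta> \<Longrightarrow> \<Delta> \<turnstile> a"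
proof (induction arbitrary: \<Delta> rule: proves.induct)
  case (Assm a \<Gamma>)
  then show ?case by (auto intro: proves.Assm)
next
  case (ImpI a \<Gamma> b)
  show ?case by (rule proves.ImpI, rule ImpI.IH) (use ImpI.prems in auto)
next
  case (ImpE \<Gamma> a b)
  show ?case by (rule proves.ImpE[OF ImpE.IH]) (fact ImpE.prems)+
next
  case (RAA a \<Gamma>)
  show ?case by (rule proves.RAA, rule RAA.IH) (use RAA.prems in auto)
next
  case (AllI \<Gamma> a)
  show ?case by (rule proves.AllI, rule AllI.IH) (use AllI.prems in auto)
next
  case (AllE \<Gamma> a t)
  show ?case by (rule proves.AllE, rule AllE.IH) (fact AllE.prems)
next
  case (Refl \<Gamma> t)
  show ?case by (rule proves.Refl)
next
  case (Leibniz \<Gamma> t u a)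
  show ?case by (rule proves.Leibniz[OF Leibniz.IH]) (fact Leibniz.prems)+
qed

text \<open>A derivation mentions only finitely many assumptions: the finite sets for the premises
  are united, and a discharged assumption is removed. This finite character carries consistency over
  to the union in \<open>henkin_extension\<close>.\<close>

lemma proves_finite: "\<Gamma> \<turnstile> a \<Longrightarrow> \<exists>\<Delta>\<subseteq>\<Gamma>. finite \<Delta> \<and> \<Delta> \<turnstile> a"
proof (induction rule: proves.induct)
  case (Assm a \<Gamma>)
  then have "{a} \<subseteq> \<Gamma> \<and> finite {a} \<and> {a} \<turnstile> a" by (simp add: proves.Assm)
  then show ?case by blast
next
  case (ImpI a \<Gamma> b)
  then obtain \<Delta> where \<Delta>: "\<Delta> \<subseteq> insert a \<Gamma>" "finite \<Delta>" "\<Delta> \<turnstile> b" by blast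
  have "\<Delta> - {a} \<turnstile> a \<^bold>\<longrightarrow> b" by (rule proves.ImpI, rule weakening[OF \<Delta>(3)]) auto
  moreover have "\<Delta> - {a} \<subseteq> \<Gamma>" "finite (\<Delta> - {a})" using \<Delta> by auto
  ultimately show ?case by blast
next
  case (ImpE \<Gamma> a b)
  then obtain \<Delta> \<Delta>' where \<Delta>: "\<Delta> \<subseteq> \<Gamma>" "finite \<Delta>" "\<Delta> \<turnstile> a \<^bold>\<longrightarrow> b" "\<Delta>' \<subseteq> \<Gamma>" "finite \<Delta>'" "\<Delta>' \<turnstile> a"
    by blast
  have "\<Delta> \<union> \<Delta>' \<turnstile> b"
    by (rule proves.ImpE[OF weakening[OF \<Delta>(3)] weakening[OF \<Delta>(6)]]) auto
  moreover have "\<Delta> \<union> \<Delta>' \<subseteq> \<Gamma>" "finite (\<Delta> \<union> \<Delta>')" using \<Delta> by auto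
  ultimately show ?case by blast
next
  case (RAA a \<Gamma>)
  then obtain \<Delta> where \<Delta>: "\<Delta> \<subseteq> insert (\<^bold>\<not> a) \<Gamma>" "finite \<Delta>" "\<Delta> \<turnstile> \<^bold>\<bottom>" by blast
  have "\<Delta> - {\<^bold>\<not> a} \<turnstile> a" by (rule proves.RAA, rule weakening[OF \<Delta>(3)]) auto
  moreover have "\<Delta> - {\<^bold>\<not> a} \<subseteq> \<Gamma>" "finite (\<Delta> - {\<^bold>\<not> a})" using \<Delta> by auto
  ultimately show ?case by blast
next
  case (AllI \<Gamma> a)
  then obtain \<Delta> where "\<Delta> \<subseteq> subst shift ` \<Gamma>" "finite \<Delta>" "\<Delta> \<turnstile> a" by blast
  \<comment> \<open>A finite subset of the shifted assumptions is the shift of a finite set of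
    assumptions, so \<open>AllI\<close> applies to that set.\<close>
  then show ?case using finite_subset_image[of \<Delta> "subst shift" \<Gamma>] proves.AllI by blast
next
  case (AllE \<Gamma> a t)
  then obtain \<Delta> where "\<Delta> \<subseteq> \<Gamma>" "finite \<Delta>" "\<Delta> \<turnstile> \<^bold>\<forall> a" by blast
  then show ?case using proves.AllE[of \<Delta> a t] by blast
next
  case (Refl \<Gamma> t)
  have "{} \<turnstile> t \<^bold>= t" by (rule proves.Refl)
  then show ?case by blast
next
  case (Leibniz \<Gamma> t u a)
  then obtain \<Delta> \<Delta>' where \<Delta>: "\<Delta> \<subseteq> \<Gamma>" "finite \<Delta>" "\<Delta> \<turnstile> t \<^bold>= u"
    "\<Delta>' \<subseteq> \<Gamma>" "finite \<Delta>'" "\<Delta>' \<turnstile> inst t a" by blast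
  have "\<Delta> \<union> \<Delta>' \<turnstile> inst u a"
    by (rule proves.Leibniz[OF weakening[OF \<Delta>(3)] weakening[OF \<Delta>(6)]]) auto
  moreover have "\<Delta> \<union> \<Delta>' \<subseteq> \<Gamma>" "finite (\<Delta> \<union> \<Delta>')" using \<Delta> by auto
  ultimately show ?case by blast
qed

lemma proves_subst: "\<Gamma> \<turnstile> a \<Longrightarrow> subst \<sigma> ` \<Gamma> \<turnstile> subst \<sigma> a"
proof (induction arbitrary: \<sigma> rule: proves.induct)
  case (AllI \<Gamma> a)
  have "subst (under_binder \<sigma>) ` subst shift ` \<Gamma> = subst shift ` subst \<sigma> ` \<Gamma>"
    by (simp add: image_image subst_comp shift_def)
  then show ?case using AllI.IH[of "under_binder \<sigma>"] by (simp add: proves.AllI)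
next
  case (AllE \<Gamma> a t)
  then show ?case
    using proves.AllE[of "subst \<sigma> ` \<Gamma>" "subst (under_binder \<sigma>) a"] by (simp add: subst_inst)
next
  case (Leibniz \<Gamma> t u a)
  then show ?case
    using proves.Leibniz[of "subst \<sigma> ` \<Gamma>" "subst_tm \<sigma> t" "subst_tm \<sigma> u" "subst (under_binder \<sigma>) a"]
    by (simp add: subst_inst)
next
  case (ImpI a \<Gamma> b)
  then show ?case using proves.ImpI[of "subst \<sigma> a" "subst \<sigma> ` \<Gamma>" "subst \<sigma> b"] by simp
next
  case (ImpE \<Gamma> a b)
  then show ?case using proves.ImpE[of "subst \<sigma> ` \<Gamma>" "subst \<sigma> a" "subst \<sigma> b"] by simp
next
  case (RAA a \<Gamma>)
  then show ?case using proves.RAA[of "subst \<sigma> a" "subst \<sigma> ` \<Gamma>"] by simp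
qed (simp_all add: Assm Refl)

text \<open>The eigenvariable rule with a named fresh variable. Sending \<open>n\<close> to 0 and
  shifting every other variable acts as plain shifting on the assumptions and turns the instance at
  \<open>Var n\<close> back into \<open>a\<close>, which is the premise of
  \<open>AllI\<close>.\<close>

lemma AllI_fresh:
  assumes "\<Gamma> \<turnstile> inst (Var n) a" and "\<And>b. b \<in> \<Gamma> \<Longrightarrow> n \<notin> free_vars b" and "n \<notin> free_vars (\<^bold>\<forall> a)"
  shows "\<Gamma> \<turnstile> \<^bold>\<forall> a"
proof -
  let ?\<sigma> = "\<lambda>i. if i = n then Var 0 else shift i"
  have "subst ?\<sigma> ` \<Gamma> = subst shift ` \<Gamma>"
    by (intro image_cong refl subst_cong) (use assms(2) in auto)
  moreover have "subst ?\<sigma> (inst (Var n) a) = subst Var a"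
    unfolding inst_def subst_comp
  proof (rule subst_cong)
    fix i assume "i \<in> free_vars a"
    then show "subst_tm ?\<sigma> (case_nat (Var n) Var i) = Var i"
      using assms(3) by (cases i) (auto simp: shift_def)
  qed
  ultimately have "subst shift ` \<Gamma> \<turnstile> a" using proves_subst[OF assms(1), of ?\<sigma>] by simp
  then show ?thesis by (rule proves.AllI)
qed

section \<open>Semantics\<close>

record 'a struct =
  zer :: 'a
  suc :: "'a \<Rightarrow> 'a"
  prd :: "'a \<Rightarrow> 'a"
  pls :: "'a \<Rightarrow> 'a \<Rightarrow> 'a"
  tri :: "'a \<Rightarrow> 'a \<Rightarrow> bool"

primrec eval :: "'a struct \<Rightarrow> (nat \<Rightarrow> 'a) \<Rightarrow> tm \<Rightarrow> 'a" where
  "eval M e (Var n) = e n"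
| "eval M e \<^bold>0 = zer M"
| "eval M e (\<^bold>s t) = suc M (eval M e t)"
| "eval M e (\<^bold>p t) = prd M (eval M e t)"
| "eval M e (t \<^bold>+ u) = pls M (eval M e t) (eval M e u)"

primrec sat :: "'a struct \<Rightarrow> (nat \<Rightarrow> 'a) \<Rightarrow> fm \<Rightarrow> bool" where
  "sat M e \<^bold>\<bottom> = False"
| "sat M e (t \<^bold>= u) = (eval M e t = eval M e u)"
| "sat M e (t \<triangleright> u) = tri M (eval M e t) (eval M e u)"
| "sat M e (a \<^bold>\<longrightarrow> b) = (sat M e a \<longrightarrow> sat M e b)"
| "sat M e (\<^bold>\<forall> a) = (\<forall>x. sat M (case_nat x e) a)"

definition models :: "'a struct \<Rightarrow> fm set \<Rightarrow> bool" where
  "models M \<Gamma> \<longleftrightarrow> (\<forall>a\<in>\<Gamma>. \<forall>e. sat M e a)"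

lemma models_Un [simp]: "models M (\<Gamma> \<union> \<Delta>) \<longleftrightarrow> models M \<Gamma> \<and> models M \<Delta>"
  by (auto simp: models_def)

lemma eval_subst: "eval M e (subst_tm \<sigma> t) = eval M (\<lambda>n. eval M e (\<sigma> n)) t"
  by (induction t) auto

lemma sat_subst: "sat M e (subst \<sigma> a) = sat M (\<lambda>n. eval M e (\<sigma> n)) a"
proof (induction a arbitrary: e \<sigma>)
  case (All a)
  have "(\<lambda>n. eval M (case_nat x e) (under_binder \<sigma> n)) = case_nat x (\<lambda>n. eval M e (\<sigma> n))" for x
  proof
    fix n show "eval M (case_nat x e) (under_binder \<sigma> n) = case_nat x (\<lambda>n. eval M e (\<sigma> n)) n"
      by (cases n) (auto simp: eval_subst shift_def)
  qed
  then show ?case by (simp add: All)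
qed (auto simp: eval_subst)

lemma sat_inst: "sat M e (inst t a) = sat M (case_nat (eval M e t) e) a"
proof -
  have "(\<lambda>n. eval M e (case_nat t Var n)) = case_nat (eval M e t) e"
    by (auto split: nat.splits)
  then show ?thesis by (simp add: inst_def sat_subst)
qed

lemma soundness: "\<Gamma> \<turnstile> a \<Longrightarrow> (\<And>b. b \<in> \<Gamma> \<Longrightarrow> sat M e b) \<Longrightarrow> sat M e a"
proof (induction arbitrary: e rule: proves.induct)
  case (ImpI a \<Gamma> b)
  then show ?case using ImpI.IH[of e] by auto
next
  case (RAA a \<Gamma>)
  show ?case
  proof (rule ccontr)
    assume "\<not> sat M e a"
    then have "sat M e \<^bold>\<bottom>" by (intro RAA.IH) (use RAA.prems in auto)
    then show False by simp
  qed
next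
  case (AllI \<Gamma> a)
  have "sat M (case_nat x e) a" for x
    by (rule AllI.IH) (use AllI.prems in \<open>auto simp: sat_subst shift_def\<close>)
  then show ?case by simp
next
  case (AllE \<Gamma> a t)
  then show ?case by (simp add: sat_inst)
next
  case (Leibniz \<Gamma> t u a)
  then show ?case by (simp add: sat_inst)
qed auto

section \<open>Completeness\<close>

text \<open>Countability of formulas provides the enumeration in \<open>henkin_extension\<close>;
  countability of terms allows their classes to be numbered in \<open>completeness\<close>.\<close>

instance tm :: countable by countable_datatype
instance fm :: countable by countable_datatype

definition consistent :: "fm set \<Rightarrow> bool" where
  "consistent \<Gamma> \<longleftrightarrow> \<not> \<Gamma> \<turnstile> \<^bold>\<bottom>"

text \<open>Finitely many free variables leave a fresh \<open>k\<close>. If adding the negated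
  instance at \<open>k\<close> were inconsistent, the instance itself would be derivable, and
  generalizing over \<open>k\<close> would contradict the negated universal formula.\<close>

lemma consistent_insert_witness:
  assumes "consistent (insert (\<^bold>\<not> (\<^bold>\<forall> b)) \<Gamma>)" and "finite (\<Union> (free_vars ` \<Gamma>))"
  obtains k where "consistent (insert (\<^bold>\<not> inst (Var k) b) (insert (\<^bold>\<not> (\<^bold>\<forall> b)) \<Gamma>))"
proof -
  have "finite (\<Union> (free_vars ` insert (\<^bold>\<not> (\<^bold>\<forall> b)) \<Gamma>))" using assms(2) finite_free_vars[of "\<^bold>\<forall> b"] by simp
  then obtain k where k: "k \<notin> \<Union> (free_vars ` insert (\<^bold>\<not> (\<^bold>\<forall> b)) \<Gamma>)"
    using ex_new_if_finite infinite_UNIV_nat by blast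
  have "consistent (insert (\<^bold>\<not> inst (Var k) b) (insert (\<^bold>\<not> (\<^bold>\<forall> b)) \<Gamma>))"
    unfolding consistent_def
  proof
    assume "insert (\<^bold>\<not> inst (Var k) b) (insert (\<^bold>\<not> (\<^bold>\<forall> b)) \<Gamma>) \<turnstile> \<^bold>\<bottom>"
    then have "insert (\<^bold>\<not> (\<^bold>\<forall> b)) \<Gamma> \<turnstile> inst (Var k) b" by (rule RAA)
    then have "insert (\<^bold>\<not> (\<^bold>\<forall> b)) \<Gamma> \<turnstile> \<^bold>\<forall> b" using k by (intro AllI_fresh[of _ k]) auto
    then have "insert (\<^bold>\<not> (\<^bold>\<forall> b)) \<Gamma> \<turnstile> \<^bold>\<bottom>" by (meson Assm ImpE insertI1)
    then show False using assms(1) by (simp add: consistent_def)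
  qed
  then show ?thesis by (rule that)
qed

text \<open>One stage of the Henkin construction. Finiteness of the set of free variables is part of
  the invariant so that a fresh witness is still available at the next stage.\<close>

lemma henkin_step:
  assumes "consistent \<Gamma>" and fin: "finite (\<Union> (free_vars ` \<Gamma>))"
  shows "\<exists>\<Delta>. (consistent \<Delta> \<and> finite (\<Union> (free_vars ` \<Delta>))) \<and> \<Gamma> \<subseteq> \<Delta> \<and>
    (consistent (insert a \<Gamma>) \<longrightarrow> a \<in> \<Delta> \<and> (\<forall>b. a = \<^bold>\<not> (\<^bold>\<forall> b) \<longrightarrow> (\<exists>t. (\<^bold>\<not> inst t b) \<in> \<Delta>)))"
proof (cases "consistent (insert a \<Gamma>)")
  case True
  show ?thesis
  proof (cases "\<exists>b. a = \<^bold>\<not> (\<^bold>\<forall> b)")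
    case b: True
    then obtain b where b: "a = \<^bold>\<not> (\<^bold>\<forall> b)" by blast
    obtain k where "consistent (insert (\<^bold>\<not> inst (Var k) b) (insert a \<Gamma>))"
      using consistent_insert_witness fin True b by metis
    then show ?thesis using fin b finite_free_vars[of a]
      by (intro exI[of _ "insert (\<^bold>\<not> inst (Var k) b) (insert a \<Gamma>)"]) auto
  next
    case False
    then show ?thesis using fin True by (intro exI[of _ "insert a \<Gamma>"]) auto
  qed
qed (use assms in auto)

section \<open>Henkin sets and their term models\<close>

locale henkin =
  fixes H :: "fm set"
  assumes cons: "consistent H"
    and maximal: "consistent (insert a H) \<Longrightarrow> a \<in> H"
    and witness: "(\<^bold>\<not> (\<^bold>\<forall> b)) \<in> H \<Longrightarrow> \<exists>t. (\<^bold>\<not> inst t b) \<in> H"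

lemma henkin_extension:
  assumes "consistent \<Gamma>" and "finite (\<Union> (free_vars ` \<Gamma>))"
  obtains H where "henkin H" "\<Gamma> \<subseteq> H"
proof -
  \<comment> \<open>The clause for \<open>n = 0\<close> pins the first stage to \<Gamma>; stage
    \<open>n\<close> then treats the formula with code \<open>n\<close>.\<close>
  let ?P = "\<lambda>(n::nat) \<Delta>. consistent \<Delta> \<and> finite (\<Union> (free_vars ` \<Delta>)) \<and> (n = 0 \<longrightarrow> \<Delta> = \<Gamma>)"
  let ?Q = "\<lambda>n \<Delta> \<Delta>'. \<Delta> \<subseteq> \<Delta>' \<and> (consistent (insert (from_nat n) \<Delta>) \<longrightarrow>
      from_nat n \<in> \<Delta>' \<and> (\<forall>b. from_nat n = (\<^bold>\<not> (\<^bold>\<forall> b)) \<longrightarrow> (\<exists>t. (\<^bold>\<not> inst t b) \<in> \<Delta>')))"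
  have "\<exists>S. \<forall>n. ?P n (S n) \<and> ?Q n (S n) (S (Suc n))"
  proof (rule dependent_nat_choice)
    show "\<exists>\<Delta>. ?P 0 \<Delta>" using assms by auto
  next
    fix \<Delta> n assume "?P n \<Delta>"
    then show "\<exists>\<Delta>'. ?P (Suc n) \<Delta>' \<and> ?Q n \<Delta> \<Delta>'"
      using henkin_step[of \<Delta> "from_nat n"] by auto
  qed
  then obtain S where P: "\<And>n. ?P n (S n)" and Q: "\<And>n. ?Q n (S n) (S (Suc n))" by blast
  have mono: "S m \<subseteq> S n" if "m \<le> n" for m n
    using lift_Suc_mono_le[of S] Q that by blast
  let ?H = "\<Union> (range S)"
  have sub: "\<exists>n. F \<subseteq> S n" if "finite F" "F \<subseteq> ?H" for F
    using that
  proof (induction F)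
    case (insert a F)
    then obtain m n where "F \<subseteq> S n" "a \<in> S m" by auto
    then show ?case using mono[of m "max m n"] mono[of n "max m n"] by (intro exI[of _ "max m n"]) auto
  qed auto
  have cons: "consistent ?H"
    unfolding consistent_def
  proof
    assume "?H \<turnstile> \<^bold>\<bottom>"
    then obtain F where "F \<subseteq> ?H" "finite F" "F \<turnstile> \<^bold>\<bottom>" using proves_finite by blast
    then obtain n where "S n \<turnstile> \<^bold>\<bottom>" using sub weakening by meson
    then show False using P[of n] by (simp add: consistent_def)
  qed
  have step: "a \<in> ?H \<and> (\<forall>b. a = (\<^bold>\<not> (\<^bold>\<forall> b)) \<longrightarrow> (\<exists>t. (\<^bold>\<not> inst t b) \<in> ?H))"
    if "consistent (insert a ?H)" for a
  proof -
    \<comment> \<open>A formula consistent with the union is consistent with the stage at which it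
      is treated, hence was accepted there together with its witness.\<close>
    have "insert a (S (to_nat a)) \<subseteq> insert a ?H" by auto
    then have "consistent (insert a (S (to_nat a)))"
      using that weakening unfolding consistent_def by blast
    then show ?thesis using Q[of "to_nat a"] unfolding from_nat_to_nat by blast
  qed
  have "henkin ?H"
  proof
    show "\<exists>t. (\<^bold>\<not> inst t b) \<in> ?H" if "(\<^bold>\<not> (\<^bold>\<forall> b)) \<in> ?H" for b
      using step[of "\<^bold>\<not> (\<^bold>\<forall> b)"] cons that by (simp only: insert_absorb)
  qed (use cons step in auto)
  moreover have "\<Gamma> \<subseteq> ?H" using P[of 0] by auto
  ultimately show ?thesis by (rule that)
qed

context henkin
begin

lemma deriv_mem: "H \<turnstile> a \<longleftrightarrow> a \<in> H"
proof
  assume a: "H \<turnstile> a"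
  have "\<not> insert a H \<turnstile> \<^bold>\<bottom>"
    using a cons unfolding consistent_def by (meson ImpI ImpE)
  then show "a \<in> H" using maximal by (simp add: consistent_def)
qed (rule Assm)

lemma Falsity_notin: "\<^bold>\<bottom> \<notin> H"
  using cons deriv_mem by (simp add: consistent_def)

lemma Imp_mem_iff: "(a \<^bold>\<longrightarrow> b) \<in> H \<longleftrightarrow> (a \<in> H \<longrightarrow> b \<in> H)"
proof
  show "(a \<^bold>\<longrightarrow> b) \<in> H \<Longrightarrow> a \<in> H \<longrightarrow> b \<in> H" using deriv_mem ImpE by blast
next
  assume ab: "a \<in> H \<longrightarrow> b \<in> H"
  show "(a \<^bold>\<longrightarrow> b) \<in> H"
  proof (cases "b \<in> H")
    case True
    then have "insert a H \<turnstile> b" by (simp add: Assm)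
    then show ?thesis using ImpI deriv_mem by blast
  next
    case False
    \<comment> \<open>Here \<open>a\<close> is outside \<open>H\<close> as well, so maximality makes
      it refutable, and anything follows from it.\<close>
    then have "insert a H \<turnstile> \<^bold>\<bottom>" using ab maximal by (auto simp: consistent_def)
    then have "insert (\<^bold>\<not> b) (insert a H) \<turnstile> \<^bold>\<bottom>" by (rule weakening) auto
    then have "insert a H \<turnstile> b" by (rule RAA)
    then show ?thesis using ImpI deriv_mem by blast
  qed
qed

text \<open>The converse direction uses the witnesses: if the universal formula were missing, its
  negation would be in \<open>H\<close> and would supply an instance whose negation is in
  \<open>H\<close>.\<close>

lemma All_mem_iff: "(\<^bold>\<forall> a) \<in> H \<longleftrightarrow> (\<forall>t. inst t a \<in> H)"
proof
  show "(\<^bold>\<forall> a) \<in> H \<Longrightarrow> \<forall>t. inst t a \<in> H" using deriv_mem AllE by blast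
next
  assume "\<forall>t. inst t a \<in> H"
  then have "(\<^bold>\<not> (\<^bold>\<forall> a)) \<notin> H" using witness Imp_mem_iff Falsity_notin by blast
  then show "(\<^bold>\<forall> a) \<in> H" using Imp_mem_iff by blast
qed

lemma Eq_refl: "(t \<^bold>= t) \<in> H"
  using deriv_mem Refl by blast

lemma Eq_Leibniz: "(t \<^bold>= u) \<in> H \<Longrightarrow> inst t a \<in> H \<Longrightarrow> inst u a \<in> H"
  using deriv_mem Leibniz by blast

text \<open>In this and the following congruence laws, variable 0 of the template marks the place of
  replacement; terms that must stay fixed are shifted, since \<open>inst\<close> undoes the
  shift.\<close>

lemma Eq_sym: "(t \<^bold>= u) \<in> H \<Longrightarrow> (u \<^bold>= t) \<in> H"
  using Eq_Leibniz[of t u "Var 0 \<^bold>= subst_tm shift t"] by (simp add: inst_def Eq_refl)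

lemma Eq_trans: "(t \<^bold>= u) \<in> H \<Longrightarrow> (u \<^bold>= v) \<in> H \<Longrightarrow> (t \<^bold>= v) \<in> H"
  using Eq_Leibniz[of u v "subst_tm shift t \<^bold>= Var 0"] by (simp add: inst_def)

lemma Eq_Succ: "(t \<^bold>= u) \<in> H \<Longrightarrow> (\<^bold>s t \<^bold>= \<^bold>s u) \<in> H"
  using Eq_Leibniz[of t u "subst_tm shift (\<^bold>s t) \<^bold>= \<^bold>s (Var 0)"] by (simp add: inst_def Eq_refl)

lemma Eq_Pred: "(t \<^bold>= u) \<in> H \<Longrightarrow> (\<^bold>p t \<^bold>= \<^bold>p u) \<in> H"
  using Eq_Leibniz[of t u "subst_tm shift (\<^bold>p t) \<^bold>= \<^bold>p (Var 0)"] by (simp add: inst_def Eq_refl)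

lemma Eq_Plus:
  assumes "(t \<^bold>= t') \<in> H" and "(u \<^bold>= u') \<in> H"
  shows "(t \<^bold>+ u \<^bold>= t' \<^bold>+ u') \<in> H"
proof -
  have "(t \<^bold>+ u \<^bold>= t' \<^bold>+ u) \<in> H"
    using Eq_Leibniz[OF assms(1), of "subst_tm shift (t \<^bold>+ u) \<^bold>= Var 0 \<^bold>+ subst_tm shift u"]
    by (simp add: inst_def Eq_refl)
  then show ?thesis
    using Eq_Leibniz[OF assms(2), of "subst_tm shift (t \<^bold>+ u) \<^bold>= subst_tm shift t' \<^bold>+ Var 0"]
    by (simp add: inst_def)
qed

lemma Tri_cong:
  assumes "(t \<^bold>= t') \<in> H" and "(u \<^bold>= u') \<in> H"
  shows "(t \<triangleright> u) \<in> H \<longleftrightarrow> (t' \<triangleright> u') \<in> H"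
proof -
  have imp: "(b \<triangleright> d) \<in> H" if "(a \<triangleright> c) \<in> H" "(a \<^bold>= b) \<in> H" "(c \<^bold>= d) \<in> H" for a b c d
  proof -
    have "(b \<triangleright> c) \<in> H"
      using that(1) Eq_Leibniz[OF that(2), of "Var 0 \<triangleright> subst_tm shift c"] by (simp add: inst_def)
    then show ?thesis
      using Eq_Leibniz[OF that(3), of "subst_tm shift b \<triangleright> Var 0"] by (simp add: inst_def)
  qed
  show ?thesis using imp[of t u t' u'] imp[of t' u' t u] assms Eq_sym by blast
qed

definition eqclass :: "tm \<Rightarrow> tm set" where
  "eqclass t = {u. (t \<^bold>= u) \<in> H}"

lemma eqclass_eq_iff: "eqclass t = eqclass u \<longleftrightarrow> (t \<^bold>= u) \<in> H"
  unfolding eqclass_def using Eq_refl Eq_sym Eq_trans by blast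

text \<open>Numerals lie in distinct classes: a successor is never zero, and the predecessor makes
  the successor injective.\<close>

lemma infinite_range_eqclass:
  assumes "T_tri \<subseteq> H"
  shows "infinite (range eqclass)"
proof -
  have 1: "(\<^bold>\<forall> \<^bold>\<not> (\<^bold>s Var 0 \<^bold>= \<^bold>0)) \<in> H" and 2: "(\<^bold>\<forall> (\<^bold>p \<^bold>s Var 0 \<^bold>= Var 0)) \<in> H"
    using assms by (auto simp: T_tri_def Let_def)
  have s0: "(\<^bold>s t \<^bold>= \<^bold>0) \<notin> H" for t
    using 1 by (simp add: All_mem_iff inst_def Imp_mem_iff Falsity_notin)
  have ps: "(\<^bold>p \<^bold>s t \<^bold>= t) \<in> H" for t
    using 2 by (simp add: All_mem_iff inst_def)
  define numeral where "numeral n = (Succ ^^ n) \<^bold>0" for n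
  have "m = n" if "(numeral m \<^bold>= numeral n) \<in> H" for m n
    using that
  proof (induction m arbitrary: n)
    case 0
    then show ?case using s0 Eq_sym by (cases n) (auto simp: numeral_def)
  next
    case (Suc m)
    show ?case
    proof (cases n)
      case 0
      then show ?thesis using Suc.prems s0 by (auto simp: numeral_def)
    next
      case (Suc k)
      then have "(\<^bold>s numeral m \<^bold>= \<^bold>s numeral k) \<in> H" using Suc.prems by (simp add: numeral_def)
      then have "(numeral m \<^bold>= numeral k) \<in> H" using ps Eq_Pred Eq_sym Eq_trans by meson
      then show ?thesis using Suc.IH Suc by blast
    qed
  qed
  then have "inj (\<lambda>n. eqclass (numeral n))" by (auto simp: inj_def eqclass_eq_iff)
  then have "infinite (range (\<lambda>n. eqclass (numeral n)))" using finite_imageD infinite_UNIV_nat by blast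
  moreover have "range (\<lambda>n. eqclass (numeral n)) \<subseteq> range eqclass" by blast
  ultimately show ?thesis using infinite_super by blast
qed

text \<open>The truth lemma for the quotient of terms by equality in \<open>H\<close>, with
  \<open>f\<close> as quotient map onto an arbitrary type and \<open>inv f\<close> choosing
  representatives. Quantifying over all \<sigma> lets the induction pass binders, as substitutions
  stand for assignments.\<close>

lemma term_model:
  fixes f :: "tm \<Rightarrow> 'a"
  assumes "surj f" and f: "\<And>t u. f t = f u \<longleftrightarrow> (t \<^bold>= u) \<in> H"
  obtains M :: "'a struct" where "\<And>\<sigma> a. sat M (\<lambda>n. f (\<sigma> n)) a \<longleftrightarrow> subst \<sigma> a \<in> H"
proof -
  let ?r = "inv f"
  define M where "M = \<lparr>zer = f \<^bold>0, suc = \<lambda>x. f (\<^bold>s (?r x)), prd = \<lambda>x. f (\<^bold>p (?r x)),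
    pls = \<lambda>x y. f (?r x \<^bold>+ ?r y), tri = \<lambda>x y. (?r x \<triangleright> ?r y) \<in> H\<rparr>"
  have r: "f (?r x) = x" for x using assms(1) by (simp add: surj_f_inv_f)
  then have r': "(?r (f t) \<^bold>= t) \<in> H" for t using f by blast
  have eval: "eval M (\<lambda>n. f (\<sigma> n)) t = f (subst_tm \<sigma> t)" for \<sigma> t
    by (induction t) (simp_all add: M_def f Eq_Succ Eq_Pred Eq_Plus r' Eq_refl)
  have "sat M (\<lambda>n. f (\<sigma> n)) a \<longleftrightarrow> subst \<sigma> a \<in> H" for \<sigma> a
  proof (induction a arbitrary: \<sigma>)
    case (Tri t u)
    have "tri M (f t) (f u) \<longleftrightarrow> (t \<triangleright> u) \<in> H" for t u
      using Tri_cong[OF r' r'] by (simp add: M_def)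
    then show ?case by (simp add: eval)
  next
    case (All a)
    have c: "case_nat (f t) (\<lambda>n. f (\<sigma> n)) = (\<lambda>n. f (case_nat t \<sigma> n))" for t
      by (auto split: nat.splits)
    \<comment> \<open>By surjectivity of \<open>f\<close>, ranging over the domain is the same as
      ranging over terms.\<close>
    have "sat M (\<lambda>n. f (\<sigma> n)) (\<^bold>\<forall> a) \<longleftrightarrow> (\<forall>t. sat M (case_nat (f t) (\<lambda>n. f (\<sigma> n))) a)"
      unfolding sat.simps by (metis r)
    then show ?case by (simp add: c All.IH All_mem_iff inst_under_binder del: sat.simps)
  qed (simp_all add: eval f Falsity_notin Imp_mem_iff)
  then show ?thesis by (rule that)
qed

end

text \<open>Since \<open>T_tri\<close> has only infinite models, the countable quotient of the terms can be
  identified with the whole type \<open>nat\<close>, so that structures need no carrier set.\<close>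

lemma completeness:
  assumes "T_tri \<subseteq> \<Gamma>" and closed: "\<And>a. a \<in> \<Gamma> \<Longrightarrow> free_vars a = {}"
    and valid: "\<And>(M :: nat struct) e. models M \<Gamma> \<Longrightarrow> sat M e \<phi>"
  shows "\<Gamma> \<turnstile> \<phi>"
proof (rule ccontr)
  assume "\<not> \<Gamma> \<turnstile> \<phi>"
  then have "consistent (insert (\<^bold>\<not> \<phi>) \<Gamma>)" unfolding consistent_def using RAA by blast
  moreover have "finite (\<Union> (free_vars ` insert (\<^bold>\<not> \<phi>) \<Gamma>))" by (simp add: closed)
  ultimately obtain H where H: "henkin H" and sub: "insert (\<^bold>\<not> \<phi>) \<Gamma> \<subseteq> H"
    by (rule henkin_extension)
  interpret henkin H by (rule H)
  define f where "f t = to_nat_on (range eqclass) (eqclass t)" for t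
  have "T_tri \<subseteq> H" using assms(1) sub by blast
  then have bij: "bij_betw (to_nat_on (range eqclass)) (range eqclass) UNIV"
    by (intro to_nat_on_infinite infinite_range_eqclass) simp
  then have "range f = UNIV" unfolding f_def bij_betw_def by (simp add: image_image)
  then have surj: "surj f" .
  have f: "f t = f u \<longleftrightarrow> (t \<^bold>= u) \<in> H" for t u
    using bij unfolding f_def bij_betw_def eqclass_eq_iff[symmetric] by (metis inj_onD rangeI)
  obtain M :: "nat struct" where M: "\<And>\<sigma> a. sat M (\<lambda>n. f (\<sigma> n)) a \<longleftrightarrow> subst \<sigma> a \<in> H"
    using term_model[OF surj f] by blast
  have "sat M e a" if "a \<in> \<Gamma>" for e a
  proof -
    \<comment> \<open>Every assignment is represented by a substitution, and a closed axiom is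
      unchanged by that substitution.\<close>
    have "(\<lambda>n. f ((inv f \<circ> e) n)) = e" by (simp add: surj fun_eq_iff surj_f_inv_f)
    then show ?thesis using M[of "inv f \<circ> e" a] closed[OF that] that sub by (auto simp: subst_closed)
  qed
  then have "sat M (\<lambda>n. f (Var n)) \<phi>" by (intro valid) (simp add: models_def)
  then show False using M[of Var "\<^bold>\<not> \<phi>"] sub by simp
qed

section \<open>Open induction in models of the theory T_tri_I\<close>

lemma models_T_tri_iff:
  "models M T_tri \<longleftrightarrow>
    (\<forall>x. suc M x \<noteq> zer M) \<and> prd M (zer M) = zer M \<and> (\<forall>x. prd M (suc M x) = x) \<and>
    (\<forall>x. pls M x (zer M) = x) \<and> (\<forall>x y. pls M x (suc M y) = suc M (pls M x y)) \<and>
    tri M (zer M) (zer M) \<and>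
    (\<forall>x y. tri M x y \<longrightarrow> tri M (suc M x) (pls M (suc M x) y)) \<and>
    (\<forall>x y. tri M (suc M x) (pls M (suc M x) y) \<longrightarrow> tri M x y) \<and>
    (\<forall>x y z. tri M x y \<and> tri M x z \<longrightarrow> y = z)"
  unfolding models_def T_tri_def Let_def by (auto simp: numeral_2_eq_2)

lemma models_T_tri_I_iff:
  "models M T_tri_I \<longleftrightarrow> models M T_tri \<and>
    (\<forall>x. x \<noteq> zer M \<longrightarrow> x = suc M (prd M x)) \<and>
    (\<forall>x y. pls M x y = pls M y x) \<and>
    (\<forall>x y z. pls M (pls M x y) z = pls M x (pls M y z)) \<and>
    (\<forall>x y z. pls M x y = pls M x z \<longrightarrow> y = z)"
  unfolding T_tri_I_def models_Un by (auto simp: models_def Let_def numeral_2_eq_2)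

section \<open>Standard multiples, chains and \<triangleright> in a model\<close>

locale T_tri_I_model =
  fixes M :: "'a struct"
  assumes model: "models M T_tri_I"
begin

abbreviation plus_M (infixl "\<oplus>" 65) where "x \<oplus> y \<equiv> pls M x y"
abbreviation one_M ("\<one>") where "\<one> \<equiv> suc M (zer M)"

lemma suc_neq_zer: "suc M x \<noteq> zer M"
  and tri_suc: "tri M x y \<Longrightarrow> tri M (suc M x) (suc M x \<oplus> y)"
  and tri_functional: "tri M x y \<Longrightarrow> tri M x z \<Longrightarrow> y = z"
  and suc_prd: "x \<noteq> zer M \<Longrightarrow> suc M (prd M x) = x"
  and plus_cancel: "x \<oplus> y = x \<oplus> z \<longleftrightarrow> y = z"
  using model unfolding models_T_tri_I_iff models_T_tri_iff by metis+

lemma suc_eq: "suc M x = x \<oplus> \<one>"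
  using model unfolding models_T_tri_I_iff models_T_tri_iff by metis

sublocale pl: comm_monoid "pls M" "zer M"
  by unfold_locales (use model in \<open>unfold models_T_tri_I_iff models_T_tri_iff, metis\<close>)+

lemmas pl_ac = pl.assoc pl.commute pl.left_commute

lemma plus_cancel_right: "y \<oplus> x = z \<oplus> x \<longleftrightarrow> y = z"
  using plus_cancel by (simp add: pl.commute)

text \<open>Multiples by standard natural numbers of a possibly nonstandard element. They serve as
  slopes and as distances along chains.\<close>

definition times (infixr "\<cdot>" 70) where "n \<cdot> x = (pls M x ^^ n) (zer M)"

lemma times_0 [simp]: "0 \<cdot> x = zer M" and times_Suc: "Suc n \<cdot> x = x \<oplus> n \<cdot> x"
  by (simp_all add: times_def)

lemma times_1 [simp]: "Suc 0 \<cdot> x = x"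
  by (simp add: times_Suc)

lemma times_add: "(m + n) \<cdot> x = m \<cdot> x \<oplus> n \<cdot> x"
  by (induction m) (simp_all add: times_Suc pl_ac)

lemma times_plus: "n \<cdot> (x \<oplus> y) = n \<cdot> x \<oplus> n \<cdot> y"
  by (induction n) (simp_all add: times_Suc pl_ac)

lemma times_times: "m \<cdot> n \<cdot> x = (m * n) \<cdot> x"
  by (induction m) (simp_all add: times_Suc times_add)

lemma times_one_eq_zer_iff: "n \<cdot> \<one> = zer M \<longleftrightarrow> n = 0"
proof (cases n)
  case (Suc k)
  have "n \<cdot> \<one> = suc M (k \<cdot> \<one>)" using Suc suc_eq[of "k \<cdot> \<one>"] by (simp add: times_Suc pl_ac)
  then show ?thesis using Suc suc_neq_zer by simp
qed simp

text \<open>The standard numerals embed injectively: after cancellation, a coincidence would make a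
  positive multiple of \<one> equal to zero.\<close>

lemma times_one_eq_iff: "m \<cdot> \<one> = n \<cdot> \<one> \<longleftrightarrow> m = n"
proof -
  have "m \<cdot> \<one> \<noteq> (m + Suc k) \<cdot> \<one>" for m k
    using plus_cancel[of "m \<cdot> \<one>" "zer M" "Suc k \<cdot> \<one>"] times_one_eq_zer_iff[of "Suc k"]
    unfolding times_add pl.right_neutral by (metis nat.distinct(1))
  then show ?thesis by (metis less_imp_Suc_add linorder_neqE_nat add_Suc_right)
qed

text \<open>Only standard distances count, so elements a nonstandard distance apart are
  incomparable. In particular, two different chains need not be comparable with each other.\<close>

definition before (infix "\<prec>" 50) where "x \<prec> y \<longleftrightarrow> (\<exists>d>0. y = x \<oplus> d \<cdot> \<one>)"

lemma before_irrefl: "\<not> x \<prec> x"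
  using plus_cancel[of x "zer M"] times_one_eq_zer_iff unfolding before_def
  by (metis less_irrefl pl.right_neutral)

lemma before_trans: "x \<prec> y \<Longrightarrow> y \<prec> z \<Longrightarrow> x \<prec> z"
  unfolding before_def by (metis add_pos_pos pl.assoc times_add)

text \<open>The order of a descending sequence is reversed, but it is still a chain for \<open>\<prec>\<close>.\<close>

lemma sequence_chain:
  assumes "(\<forall>i. X (Suc i) = X i \<oplus> \<one>) \<or> (\<forall>i. X i = X (Suc i) \<oplus> \<one>)"
  shows "infinite (range X)" and "\<And>x y. x \<in> range X \<Longrightarrow> y \<in> range X \<Longrightarrow> x \<noteq> y \<Longrightarrow> x \<prec> y \<or> y \<prec> x"
proof -
  have X: "(\<forall>i. X (i + k) = X i \<oplus> k \<cdot> \<one>) \<or> (\<forall>i. X i = X (i + k) \<oplus> k \<cdot> \<one>)" for k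
    using assms
  proof
    assume "\<forall>i. X (Suc i) = X i \<oplus> \<one>"
    then have "X (i + k) = X i \<oplus> k \<cdot> \<one>" for i by (induction k) (simp_all add: times_Suc pl_ac)
    then show ?thesis by blast
  next
    assume *: "\<forall>i. X i = X (Suc i) \<oplus> \<one>"
    have "X i = X (i + k) \<oplus> k \<cdot> \<one>" for i
    proof (induction k)
      case (Suc k)
      have "X (i + k) = X (i + Suc k) \<oplus> \<one>" using *[rule_format, of "i + k"] by simp
      with Suc show ?case by (simp add: times_Suc pl_ac)
    qed simp
    then show ?thesis by blast
  qed
  have lt: "X i \<prec> X j \<or> X j \<prec> X i" if "i < j" for i j
    using X[of "j - i"] that unfolding before_def by (metis add_diff_inverse_nat less_asym zero_less_diff)
  have "inj X"
    by (rule injI) (metis before_irrefl linorder_neqE_nat lt)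
  then show "infinite (range X)" by (simp add: finite_image_iff)
  show "x \<prec> y \<or> y \<prec> x" if "x \<in> range X" "y \<in> range X" "x \<noteq> y" for x y
    using that lt by (metis linorder_neqE_nat rangeE)
qed

text \<open>The filter expresses "at all but finitely many points of \<open>C\<close>". If
  \<open>P\<close> held infinitely often on \<open>C\<close>, three distinct such points could be
  sorted into an ascending triple.\<close>

lemma eventually_sparse_on_chain:
  assumes chain: "\<And>x y. x \<in> C \<Longrightarrow> y \<in> C \<Longrightarrow> x \<noteq> y \<Longrightarrow> x \<prec> y \<or> y \<prec> x"
    and sparse: "\<And>a b c. P a \<Longrightarrow> P b \<Longrightarrow> P c \<Longrightarrow> a \<prec> b \<Longrightarrow> b \<prec> c \<Longrightarrow> False"
  shows "eventually (\<lambda>x. \<not> P x) (inf cofinite (principal C))"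
proof (rule ccontr)
  assume "\<not> ?thesis"
  then have "infinite {x \<in> C. P x}"
    by (simp add: eventually_inf_principal eventually_cofinite)
  then obtain B where "card B = 3" and B: "B \<subseteq> {x \<in> C. P x}"
    using infinite_arbitrarily_large by blast
  then obtain x y z where "B = {x, y, z}" "x \<noteq> y" "x \<noteq> z" "y \<noteq> z" by (auto simp: card_3_iff)
  then have "P x" "P y" "P z" "x \<prec> y \<or> y \<prec> x" "x \<prec> z \<or> z \<prec> x" "y \<prec> z \<or> z \<prec> y"
    using B chain by auto
  then show False using sparse before_trans by metis
qed

text \<open>Each use of \<open>tri_suc\<close> adds the new first coordinate to the second one;
  summing these contributions gives the multiple of \<open>x\<close> and the triangular
  number.\<close>

lemma tri_shift: "tri M x y \<Longrightarrow> tri M (x \<oplus> k \<cdot> \<one>) (y \<oplus> k \<cdot> x \<oplus> \<Sum>{..k} \<cdot> \<one>)"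
proof (induction k)
  case (Suc k)
  have "suc M (x \<oplus> k \<cdot> \<one>) = x \<oplus> Suc k \<cdot> \<one>"
    by (simp add: suc_eq[of "x \<oplus> k \<cdot> \<one>"] times_Suc pl_ac)
  moreover have "x \<oplus> Suc k \<cdot> \<one> \<oplus> (y \<oplus> k \<cdot> x \<oplus> \<Sum>{..k} \<cdot> \<one>) = y \<oplus> Suc k \<cdot> x \<oplus> \<Sum>{..Suc k} \<cdot> \<one>"
    by (simp add: times_Suc times_add pl_ac)
  ultimately show ?case using tri_suc[OF Suc.IH[OF Suc.prems]] by simp
qed simp

text \<open>The second coordinate of \<open>\<triangleright>\<close> grows quadratically along a chain, so three points of a
  chain are never mapped into \<open>\<triangleright>\<close> by two affine functions, the first of which has slope \<open>m > 0\<close>.\<close>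

lemma tri_affine_sparse:
  assumes "m > 0" "d > 0" "e > 0"
    and a: "tri M t y" and b: "tri M (t \<oplus> (m * d) \<cdot> \<one>) (y \<oplus> (n * d) \<cdot> \<one>)"
    and c: "tri M (t \<oplus> (m * d) \<cdot> \<one> \<oplus> (m * e) \<cdot> \<one>) (y \<oplus> (n * d) \<cdot> \<one> \<oplus> (n * e) \<cdot> \<one>)"
  shows False
proof -
  let ?J = "m * d" and ?K = "m * e"
  \<comment> \<open>By functionality, the second coordinate reached by \<open>tri_shift\<close> must
    equal the prescribed affine value.\<close>
  have 1: "(n * d) \<cdot> \<one> = ?J \<cdot> t \<oplus> \<Sum>{..?J} \<cdot> \<one>"
    using tri_functional[OF tri_shift[OF a] b] by (simp add: pl.assoc plus_cancel)
  have 2: "(n * e) \<cdot> \<one> = ?K \<cdot> (t \<oplus> ?J \<cdot> \<one>) \<oplus> \<Sum>{..?K} \<cdot> \<one>"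
    using tri_functional[OF tri_shift[OF b] c] by (simp add: pl.assoc plus_cancel)
  \<comment> \<open>Scaling the two displacements to a common multiple eliminates \<open>n\<close>.
    The possibly nonstandard \<open>t\<close> then has the same coefficient on both sides and
    cancels, leaving an equation between standard numbers.\<close>
  have "e \<cdot> ((n * d) \<cdot> \<one>) = d \<cdot> ((n * e) \<cdot> \<one>)" by (simp add: times_times mult_ac)
  then have "(e * ?J) \<cdot> t \<oplus> (e * \<Sum>{..?J}) \<cdot> \<one> =
      (e * ?J) \<cdot> t \<oplus> (d * ?K * ?J + d * \<Sum>{..?K}) \<cdot> \<one>"
    unfolding 1 2 by (simp add: times_plus times_times times_add pl.assoc mult_ac)
  then have "e * \<Sum>{..?J} = d * ?K * ?J + d * \<Sum>{..?K}" by (simp only: plus_cancel times_one_eq_iff)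
  then have "e * (2 * \<Sum>{..?J}) = 2 * (d * ?K * ?J) + d * (2 * \<Sum>{..?K})" by algebra
  moreover have "2 * \<Sum>{..k} = k * (k + 1)" for k :: nat by (induction k) auto
  \<comment> \<open>Since \<open>d * ?K = e * ?J\<close>, a common positive factor appears; dividing
    by it would force \<open>?J + ?K = 0\<close>.\<close>
  ultimately have "(e * ?J) * (?J + 1) = (e * ?J) * (2 * ?J + (?K + 1))" by (simp add: algebra_simps)
  then show False using assms(1-3) by simp
qed

end

section \<open>Eventual behaviour of terms and open formulas\<close>

locale sparse_filter = T_tri_I_model +
  fixes F :: "'a filter"
  assumes nontrivial: "F \<noteq> bot"
    and sparse: "(\<And>a b c. P a \<Longrightarrow> P b \<Longrightarrow> P c \<Longrightarrow> a \<prec> b \<Longrightarrow> b \<prec> c \<Longrightarrow> False) \<Longrightarrow> \<forall>\<^sub>F x in F. \<not> P x"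
begin

text \<open>Between two solutions at distance \<open>d > 0\<close> the left side would grow by
  \<open>m * d\<close> times \<one>, which is nonzero.\<close>

lemma affine_eq_const_sparse:
  assumes "m > 0"
  shows "\<forall>\<^sub>F x in F. m \<cdot> x \<oplus> g \<noteq> h"
proof (rule sparse)
  fix a b c assume ab: "m \<cdot> a \<oplus> g = h" "m \<cdot> b \<oplus> g = h" "a \<prec> b"
  then obtain d where "d > 0" "b = a \<oplus> d \<cdot> \<one>" by (auto simp: before_def)
  moreover have "m \<cdot> b = m \<cdot> a \<oplus> zer M" using ab by (metis plus_cancel_right pl.right_neutral)
  ultimately have "(m * d) \<cdot> \<one> = zer M" by (simp only: times_plus times_times plus_cancel)
  then show False using assms \<open>d > 0\<close> by (simp add: times_one_eq_zer_iff)
qed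

text \<open>The summand \<open>h\<close> on the left replaces a subtraction, as the model has no
  negative elements. Predecessors are absorbed into \<open>h\<close>, successors into
  \<open>g\<close>.\<close>

definition affine where
  "affine f \<longleftrightarrow> (\<exists>m g h. \<forall>\<^sub>F x in F. f x \<oplus> h = m \<cdot> x \<oplus> g)"

text \<open>With slope 0, cancelling \<open>h\<close> shows that \<open>f\<close> eventually agrees
  with its value at any one good point, and such a point exists because the filter is
  nontrivial.\<close>

lemma affine_cases:
  assumes "affine f"
  obtains (const) c where "\<forall>\<^sub>F x in F. f x = c"
  | (nonconst) m g h where "m > 0" "\<forall>\<^sub>F x in F. f x \<oplus> h = m \<cdot> x \<oplus> g"
proof -
  obtain m g h where f: "\<forall>\<^sub>F x in F. f x \<oplus> h = m \<cdot> x \<oplus> g" using assms by (auto simp: affine_def)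
  show ?thesis
  proof (cases "m = 0")
    case True
    obtain x0 where x0: "f x0 \<oplus> h = m \<cdot> x0 \<oplus> g" using eventually_happens[OF f] nontrivial by auto
    from f have "\<forall>\<^sub>F x in F. f x = f x0"
      by eventually_elim (metis True x0 times_0 plus_cancel_right)
    then show ?thesis by (rule const)
  qed (use f nonconst in auto)
qed

lemma affine_const: "affine (\<lambda>x. c)"
  unfolding affine_def by (intro exI[of _ 0] exI[of _ c] exI[of _ "zer M"]) simp

lemma affine_eventually_const: "\<forall>\<^sub>F x in F. f x = c \<Longrightarrow> affine f"
  unfolding affine_def by (intro exI[of _ 0] exI[of _ c] exI[of _ "zer M"]) simp

text \<open>The predecessor is exceptional only at zero. A function of positive slope is eventually
  nonzero, so there the predecessor subtracts \<one>; on an eventually constant function it just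
  gives another constant.\<close>

lemma affine_prd:
  assumes "affine f"
  shows "affine (\<lambda>x. prd M (f x))"
  using assms
proof (cases rule: affine_cases)
  case (const c)
  then have "\<forall>\<^sub>F x in F. prd M (f x) = prd M c" by eventually_elim simp
  then show ?thesis by (rule affine_eventually_const)
next
  case (nonconst m g h)
  have "\<forall>\<^sub>F x in F. prd M (f x) \<oplus> (h \<oplus> \<one>) = m \<cdot> x \<oplus> g"
    using nonconst(2) affine_eq_const_sparse[OF nonconst(1), of g h]
  proof eventually_elim
    case (elim x)
    then have "f x \<noteq> zer M" by auto
    then have "prd M (f x) \<oplus> \<one> = f x" using suc_prd suc_eq by metis
    then show ?case using elim by (metis pl.assoc pl.commute)
  qed
  then show ?thesis unfolding affine_def by blast
qed

text \<open>Only variable 0 varies along the filter, the parameters in \<open>e\<close> being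
  constants, and affine functions are closed under all term constructors.\<close>

lemma affine_eval: "affine (\<lambda>x. eval M (case_nat x e) t)"
proof (induction t)
  case (Var n)
  show ?case
  proof (cases n)
    case 0
    then show ?thesis unfolding affine_def
      by (intro exI[of _ 1] exI[of _ "zer M"]) simp
  qed (simp add: affine_const)
next
  case Zero
  show ?case by (simp add: affine_const)
next
  case (Succ t)
  then obtain m g h where "\<forall>\<^sub>F x in F. eval M (case_nat x e) t \<oplus> h = m \<cdot> x \<oplus> g"
    by (auto simp: affine_def)
  then have "\<forall>\<^sub>F x in F. eval M (case_nat x e) (\<^bold>s t) \<oplus> h = m \<cdot> x \<oplus> (g \<oplus> \<one>)"
    by eventually_elim (simp, metis pl.assoc pl.commute suc_eq)
  then show ?case unfolding affine_def by blast
next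
  case (Pred t)
  then show ?case by (simp add: affine_prd)
next
  case (Plus t u)
  then obtain m g h m' g' h' where
    "\<forall>\<^sub>F x in F. eval M (case_nat x e) t \<oplus> h = m \<cdot> x \<oplus> g"
    "\<forall>\<^sub>F x in F. eval M (case_nat x e) u \<oplus> h' = m' \<cdot> x \<oplus> g'"
    by (auto simp: affine_def)
  then have "\<forall>\<^sub>F x in F. eval M (case_nat x e) (t \<^bold>+ u) \<oplus> (h \<oplus> h') = (m + m') \<cdot> x \<oplus> (g \<oplus> g')"
  proof eventually_elim
    case (elim x)
    have "eval M (case_nat x e) (t \<^bold>+ u) \<oplus> (h \<oplus> h') =
        (eval M (case_nat x e) t \<oplus> h) \<oplus> (eval M (case_nat x e) u \<oplus> h')" by (simp add: pl_ac)
    also have "\<dots> = (m + m') \<cdot> x \<oplus> (g \<oplus> g')" unfolding elim by (simp add: times_add pl_ac)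
    finally show ?case .
  qed
  then show ?case unfolding affine_def by blast
qed

text \<open>Adding both offsets crosswise reduces the equation to one between two affine
  expressions. With equal slopes its truth does not depend on \<open>x\<close>; otherwise cancelling
  the smaller slope leaves an equation excluded by \<open>affine_eq_const_sparse\<close>.\<close>

lemma affine_eq_dichotomy:
  assumes "affine f" and "affine f'"
  shows "\<exists>v. \<forall>\<^sub>F x in F. (f x = f' x) = v"
proof -
  obtain m g h where f: "\<forall>\<^sub>F x in F. f x \<oplus> h = m \<cdot> x \<oplus> g" using assms(1) by (auto simp: affine_def)
  obtain m' g' h' where f': "\<forall>\<^sub>F x in F. f' x \<oplus> h' = m' \<cdot> x \<oplus> g'" using assms(2) by (auto simp: affine_def)
  have eq: "\<forall>\<^sub>F x in F. f x = f' x \<longleftrightarrow> m \<cdot> x \<oplus> (g \<oplus> h') = m' \<cdot> x \<oplus> (g' \<oplus> h)"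
    using f f'
  proof eventually_elim
    case (elim x)
    have "f x = f' x \<longleftrightarrow> f x \<oplus> (h \<oplus> h') = f' x \<oplus> (h \<oplus> h')" by (simp add: plus_cancel_right)
    also have "f x \<oplus> (h \<oplus> h') = m \<cdot> x \<oplus> (g \<oplus> h')" using elim by (metis pl.assoc)
    also have "f' x \<oplus> (h \<oplus> h') = m' \<cdot> x \<oplus> (g' \<oplus> h)" using elim by (metis pl.assoc pl.commute)
    finally show ?case .
  qed
  consider "m = m'" | d where "d > 0" "m = m' + d" | d where "d > 0" "m' = m + d"
    by (metis less_imp_add_positive linorder_neqE_nat)
  then show ?thesis
  proof cases
    case 1
    then show ?thesis using eq by (auto simp: plus_cancel)
  next
    case 2
    have "\<forall>\<^sub>F x in F. (f x = f' x) = False"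
      using eq affine_eq_const_sparse[OF 2(1), of "g \<oplus> h'" "g' \<oplus> h"]
      by eventually_elim (simp add: 2(2) times_add pl.assoc plus_cancel)
    then show ?thesis by blast
  next
    case 3
    have "\<forall>\<^sub>F x in F. (f x = f' x) = False"
      using eq affine_eq_const_sparse[OF 3(1), of "g' \<oplus> h" "g \<oplus> h'"]
      by eventually_elim (auto simp add: 3(2) times_add pl.assoc plus_cancel)
    then show ?thesis by blast
  qed
qed

lemma affine_shift:
  assumes "y \<oplus> h = m \<cdot> x \<oplus> g" and "y' \<oplus> h = m \<cdot> (x \<oplus> d \<cdot> \<one>) \<oplus> g"
  shows "y' = y \<oplus> (m * d) \<cdot> \<one>"
proof -
  have "y' \<oplus> h = (m \<cdot> x \<oplus> g) \<oplus> (m * d) \<cdot> \<one>" unfolding assms by (simp add: times_plus times_times pl_ac)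
  also have "\<dots> = (y \<oplus> (m * d) \<cdot> \<one>) \<oplus> h" unfolding assms(1)[symmetric] by (simp add: pl_ac)
  finally show ?thesis by (simp add: plus_cancel_right)
qed

lemma affine_tri_dichotomy:
  assumes "affine f" and "affine f'"
  shows "\<exists>v. \<forall>\<^sub>F x in F. tri M (f x) (f' x) = v"
  using assms(1)
proof (cases rule: affine_cases)
  case (const c)
  show ?thesis
  proof (cases "\<exists>y. tri M c y")
    case True
    then obtain y where "tri M c y" by blast
    \<comment> \<open>Functionality leaves a single possible second coordinate, so \<triangleright>
      becomes an equation with a constant.\<close>
    then have iff: "tri M c z \<longleftrightarrow> z = y" for z using tri_functional by blast
    obtain v where "\<forall>\<^sub>F x in F. (f' x = y) = v"
      using affine_eq_dichotomy[OF assms(2) affine_const] by blast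
    with const have "\<forall>\<^sub>F x in F. tri M (f x) (f' x) = v" by eventually_elim (simp add: iff)
    then show ?thesis by blast
  next
    case False
    from const have "\<forall>\<^sub>F x in F. tri M (f x) (f' x) = False" by eventually_elim (use False in blast)
    then show ?thesis by blast
  qed
next
  case (nonconst m g h)
  obtain n g' h' where f': "\<forall>\<^sub>F x in F. f' x \<oplus> h' = n \<cdot> x \<oplus> g'" using assms(2) by (auto simp: affine_def)
  \<comment> \<open>The affine equations belong to the predicate because sparsity must refute every
    ascending triple, while the equations themselves hold only eventually.\<close>
  have "\<forall>\<^sub>F x in F. \<not> (tri M (f x) (f' x) \<and> f x \<oplus> h = m \<cdot> x \<oplus> g \<and> f' x \<oplus> h' = n \<cdot> x \<oplus> g')"
  proof (rule sparse)
    fix a b c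
    assume *: "tri M (f a) (f' a) \<and> f a \<oplus> h = m \<cdot> a \<oplus> g \<and> f' a \<oplus> h' = n \<cdot> a \<oplus> g'"
      "tri M (f b) (f' b) \<and> f b \<oplus> h = m \<cdot> b \<oplus> g \<and> f' b \<oplus> h' = n \<cdot> b \<oplus> g'"
      "tri M (f c) (f' c) \<and> f c \<oplus> h = m \<cdot> c \<oplus> g \<and> f' c \<oplus> h' = n \<cdot> c \<oplus> g'"
    assume "a \<prec> b" "b \<prec> c"
    then obtain d e where d: "d > 0" "b = a \<oplus> d \<cdot> \<one>" and e: "e > 0" "c = b \<oplus> e \<cdot> \<one>"
      by (auto simp: before_def)
    have "f b = f a \<oplus> (m * d) \<cdot> \<one>" "f' b = f' a \<oplus> (n * d) \<cdot> \<one>"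
      "f c = f b \<oplus> (m * e) \<cdot> \<one>" "f' c = f' b \<oplus> (n * e) \<cdot> \<one>"
      using * d(2) e(2) affine_shift by meson+
    then show False using tri_affine_sparse[OF nonconst(1) d(1) e(1), of "f a" "f' a" n] * by simp
  qed
  with nonconst(2) f' have "\<forall>\<^sub>F x in F. tri M (f x) (f' x) = False" by eventually_elim simp
  then show ?thesis by blast
qed

lemma quantifier_free_dichotomy:
  "quantifier_free a \<Longrightarrow> \<exists>v. \<forall>\<^sub>F x in F. sat M (case_nat x e) a = v"
proof (induction a)
  case (Eq t u)
  then show ?case using affine_eq_dichotomy affine_eval by simp
next
  case (Tri t u)
  then show ?case using affine_tri_dichotomy affine_eval by simp
next
  case (Imp a b)
  then obtain v w where "\<forall>\<^sub>F x in F. sat M (case_nat x e) a = v" "\<forall>\<^sub>F x in F. sat M (case_nat x e) b = w"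
    by auto
  then have "\<forall>\<^sub>F x in F. sat M (case_nat x e) (a \<^bold>\<longrightarrow> b) = (v \<longrightarrow> w)" by eventually_elim simp
  then show ?case by blast
qed (auto intro: exI[of _ False])

end

section \<open>Open induction by comparing the two chains\<close>

lemma (in T_tri_I_model) open_induction:
  assumes "quantifier_free a" and base: "sat M (case_nat (zer M) e) a"
    and step: "\<And>x. sat M (case_nat x e) a \<Longrightarrow> sat M (case_nat (suc M x) e) a"
  shows "sat M (case_nat c e) a"
proof (rule ccontr)
  define P where "P x = sat M (case_nat x e) a" for x
  assume "\<not> sat M (case_nat c e) a"
  then have c: "\<not> P c" by (simp add: P_def)
  define X where "X n = n \<cdot> \<one>" for n
  define Y where "Y n = (prd M ^^ n) c" for n
  have PX: "P (X n)" for n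
  proof (induction n)
    case (Suc n)
    have "X (Suc n) = suc M (X n)" using suc_eq[of "n \<cdot> \<one>"] by (simp add: X_def times_Suc pl_ac)
    then show ?case using Suc step by (simp add: P_def)
  qed (simp add: X_def P_def base)
  \<comment> \<open>A failure cannot occur at zero, and by contraposition of the induction step it
    passes to the predecessor. Hence the descent from \<open>c\<close> never reaches zero.\<close>
  have pred: "y = suc M (prd M y) \<and> \<not> P (prd M y)" if "\<not> P y" for y
  proof -
    have "y \<noteq> zer M" using that base by (auto simp: P_def)
    then have "suc M (prd M y) = y" by (rule suc_prd)
    then show ?thesis using that step[of "prd M y"] by (auto simp: P_def)
  qed
  have PY: "\<not> P (Y n)" for n
    by (induction n) (simp_all add: Y_def c pred)
  have X: "(\<forall>i. X (Suc i) = X i \<oplus> \<one>) \<or> (\<forall>i. X i = X (Suc i) \<oplus> \<one>)"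
    by (simp add: X_def times_Suc pl_ac)
  have "Y i = Y (Suc i) \<oplus> \<one>" for i
    using pred[OF PY[of i]] suc_eq[of "Y (Suc i)"] by (simp add: Y_def)
  then have Y: "(\<forall>i. Y (Suc i) = Y i \<oplus> \<one>) \<or> (\<forall>i. Y i = Y (Suc i) \<oplus> \<one>)" by blast
  let ?F = "\<lambda>Z. inf cofinite (principal (range Z)) :: 'a filter"
  \<comment> \<open>A property true at all but finitely many points of an infinite range is true
    somewhere on it; otherwise the whole range would consist of exceptions.\<close>
  have hit: "\<exists>n. Q (Z n)" if "eventually Q (?F Z)" "infinite (range Z)" for Q and Z :: "nat \<Rightarrow> 'a"
  proof (rule ccontr)
    assume "\<not> ?thesis"
    then have "{x. \<not> (x \<in> range Z \<longrightarrow> Q x)} = range Z" by auto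
    then show False using that by (simp only: eventually_inf_principal eventually_cofinite)
  qed
  \<comment> \<open>Eventually for the supremum means eventually along each of the two chains, so
    the dichotomy provides one truth value common to both.\<close>
  interpret sparse_filter M "sup (?F X) (?F Y)"
  proof
    show "sup (?F X) (?F Y) \<noteq> bot"
      using hit[of "\<lambda>_. False" X] sequence_chain(1)[OF X] eventually_sup[of "\<lambda>_. False" "?F X" "?F Y"]
      by (metis eventually_bot)
    show "\<forall>\<^sub>F x in sup (?F X) (?F Y). \<not> P x"
      if "\<And>a b c. P a \<Longrightarrow> P b \<Longrightarrow> P c \<Longrightarrow> a \<prec> b \<Longrightarrow> b \<prec> c \<Longrightarrow> False" for P
      unfolding eventually_sup
      by (intro conjI eventually_sparse_on_chain[OF sequence_chain(2)[OF X] that]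
          eventually_sparse_on_chain[OF sequence_chain(2)[OF Y] that])
  qed
  obtain v where v: "eventually (\<lambda>x. P x = v) (?F X)" "eventually (\<lambda>x. P x = v) (?F Y)"
    using quantifier_free_dichotomy[OF assms(1), of e] unfolding P_def eventually_sup by blast
  show False
    using hit[OF v(1) sequence_chain(1)[OF X]] hit[OF v(2) sequence_chain(1)[OF Y]] PX PY by simp
qed

section \<open>The two theories have the same models\<close>

lemma free_vars_All_funpow: "free_vars ((All ^^ n) a) = {i. i + n \<in> free_vars a}"
  by (induction n) auto

lemma universal_closure_closed: "free_vars (universal_closure a) = {}"
proof -
  obtain k where "\<forall>i \<in> free_vars a. i < k" using finite_nat_set_iff_bounded finite_free_vars by blast
  then have "free_vars a \<subseteq> {..<k}" by auto
  then have "free_vars a \<subseteq> {..<(LEAST n. free_vars a \<subseteq> {..<n})}" by (rule LeastI)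
  then show ?thesis by (auto simp: universal_closure_def free_vars_All_funpow)
qed

text \<open>Every assignment splits into a value for variable 0 and a remaining assignment, so
  prefixing a universal quantifier preserves truth under all assignments, however often it is
  repeated.\<close>

lemma valid_universal_closure: "(\<forall>e. sat M e (universal_closure a)) \<longleftrightarrow> (\<forall>e. sat M e a)"
proof -
  have All: "(\<forall>e. sat M e (\<^bold>\<forall> b)) \<longleftrightarrow> (\<forall>e. sat M e b)" for b
  proof (intro iffI allI)
    fix e assume "\<forall>e. sat M e (\<^bold>\<forall> b)"
    then have "sat M (case_nat (e 0) (\<lambda>n. e (Suc n))) b" by simp
    moreover have "case_nat (e 0) (\<lambda>n. e (Suc n)) = e" by (auto split: nat.splits)
    ultimately show "sat M e b" by simp
  qed simp
  have "(\<forall>e. sat M e ((All ^^ n) a)) \<longleftrightarrow> (\<forall>e. sat M e a)" for n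
    by (induction n) (simp_all add: All del: sat.simps)
  then show ?thesis by (simp add: universal_closure_def)
qed

lemma valid_induction_axiom:
  "(\<forall>e. sat M e (induction_axiom a)) \<longleftrightarrow>
    (\<forall>e. sat M (case_nat (zer M) e) a \<longrightarrow>
      (\<forall>x. sat M (case_nat x e) a \<longrightarrow> sat M (case_nat (suc M x) e) a) \<longrightarrow> (\<forall>x. sat M (case_nat x e) a))"
proof -
  have "(\<lambda>n. eval M (case_nat x e) ((Var(0 := \<^bold>s Var 0)) n)) = case_nat (suc M x) e" for x e
    by (auto split: nat.splits)
  then show ?thesis
    by (simp add: induction_axiom_def valid_universal_closure sat_inst sat_subst)
qed

lemma models_IOpenD:
  assumes "models M IOpen" and "quantifier_free a" and "sat M (case_nat (zer M) e) a"
    and "\<And>x. sat M (case_nat x e) a \<Longrightarrow> sat M (case_nat (suc M x) e) a"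
  shows "sat M (case_nat x e) a"
proof -
  have "\<forall>e. sat M e (induction_axiom a)" using assms(1,2) by (auto simp: models_def IOpen_def)
  then show ?thesis using assms(3,4) unfolding valid_induction_axiom by blast
qed

lemma models_T_tri_IOpen_iff: "models M (T_tri \<union> IOpen) \<longleftrightarrow> models M T_tri_I"
proof
  assume "models M T_tri_I"
  then interpret T_tri_I_model M by unfold_locales
  have "\<forall>e. sat M e (induction_axiom a)" if "quantifier_free a" for a
    using open_induction that unfolding valid_induction_axiom by blast
  then have "models M IOpen" by (auto simp: models_def IOpen_def)
  then show "models M (T_tri \<union> IOpen)" using model by (simp add: models_T_tri_I_iff)
next
  assume M: "models M (T_tri \<union> IOpen)"
  let ?z = "zer M" and ?s = "suc M" and ?p = "prd M" and ?a = "pls M"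
  have s0: "?s x \<noteq> ?z" and ps: "?p (?s x) = x" and a0: "?a x ?z = x"
    and as: "?a x (?s y) = ?s (?a x y)" for x y
    using M by (auto simp: models_T_tri_iff)
  have inj: "?s x = ?s y \<longleftrightarrow> x = y" for x y by (metis ps)
  have ind: "sat M (case_nat x e) a"
    if "quantifier_free a" "sat M (case_nat ?z e) a"
      "\<And>x. sat M (case_nat x e) a \<Longrightarrow> sat M (case_nat (?s x) e) a" for a e x
    by (rule models_IOpenD[OF _ that(1,2)]) (use M that(3) in auto)
  \<comment> \<open>The induction variable is always \<open>?x\<close>; the parameters
    \<open>?y\<close> and \<open>?w\<close> receive their values from the assignment.\<close>
  let ?x = "Var 0" and ?y = "Var 1" and ?w = "Var 2"
  let ?e = "\<lambda>y w. case_nat y (\<lambda>_. w)"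
  have B1: "x \<noteq> ?z \<longrightarrow> x = ?s (?p x)" for x
    using ind[of "\<^bold>\<not> (?x \<^bold>= \<^bold>0) \<^bold>\<longrightarrow> ?x \<^bold>= \<^bold>s \<^bold>p ?x" "\<lambda>_. ?z" x] by (simp add: ps)
  \<comment> \<open>Induction on the last summand fits the axioms for addition, which recurse on the
    right argument.\<close>
  have B3: "?a (?a y w) x = ?a y (?a w x)" for x y w
    using ind[of "(?y \<^bold>+ ?w) \<^bold>+ ?x \<^bold>= ?y \<^bold>+ (?w \<^bold>+ ?x)" "?e y w" x]
    by (simp add: a0 as numeral_2_eq_2)
  \<comment> \<open>The recursion laws for the left argument, needed for commutativity and
    cancellation.\<close>
  have z: "?a ?z x = x" for x
    using ind[of "\<^bold>0 \<^bold>+ ?x \<^bold>= ?x" "\<lambda>_. ?z" x] by (simp add: a0 as)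
  have s: "?a (?s y) x = ?s (?a y x)" for x y
    using ind[of "\<^bold>s ?y \<^bold>+ ?x \<^bold>= \<^bold>s (?y \<^bold>+ ?x)" "\<lambda>_. y" x] by (simp add: a0 as)
  have B2: "?a y x = ?a x y" for x y
    using ind[of "?y \<^bold>+ ?x \<^bold>= ?x \<^bold>+ ?y" "\<lambda>_. y" x] by (simp add: a0 as z s)
  \<comment> \<open>Induction on the common summand: \<open>z\<close> and \<open>s\<close> peel it
    off, and injectivity removes the successors.\<close>
  have B4: "?a x y = ?a x w \<longrightarrow> y = w" for x y w
    using ind[of "?x \<^bold>+ ?y \<^bold>= ?x \<^bold>+ ?w \<^bold>\<longrightarrow> ?y \<^bold>= ?w" "?e y w" x]
    by (simp add: z s inj numeral_2_eq_2)
  show "models M T_tri_I"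
    using M B1 B2 B3 B4 unfolding models_T_tri_I_iff models_Un by blast
qed

lemma T_tri_closed: "a \<in> T_tri \<Longrightarrow> free_vars a = {}"
  by (auto simp: T_tri_def Let_def numeral_2_eq_2)

lemma T_tri_I_closed: "a \<in> T_tri_I \<Longrightarrow> free_vars a = {}"
  using T_tri_closed by (auto simp: T_tri_I_def Let_def numeral_2_eq_2)

lemma IOpen_closed: "a \<in> IOpen \<Longrightarrow> free_vars a = {}"
  by (auto simp: IOpen_def induction_axiom_def universal_closure_closed)

lemma sat_models: "\<Gamma> \<turnstile> a \<Longrightarrow> models M \<Gamma> \<Longrightarrow> sat M e a"
  by (rule soundness) (auto simp: models_def)

theorem theorem3p11:
  fixes \<phi> :: fm
  shows "T_tri \<union> IOpen \<turnstile> \<phi> \<longleftrightarrow> T_tri_I \<turnstile> \<phi>"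
proof
  assume "T_tri \<union> IOpen \<turnstile> \<phi>"
  then show "T_tri_I \<turnstile> \<phi>"
    by (intro completeness) (auto simp: T_tri_I_closed models_T_tri_IOpen_iff[symmetric] sat_models,
        simp add: T_tri_I_def)
next
  assume "T_tri_I \<turnstile> \<phi>"
  then show "T_tri \<union> IOpen \<turnstile> \<phi>"
    by (intro completeness) (auto simp: T_tri_closed IOpen_closed models_T_tri_IOpen_iff sat_models
        simp del: models_Un)
qed

end
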